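(* The set $I_{TD} = \{e : \mathrm{TD}(\mathcal L_e) < \infty\}$ is $\Sigma^0_5$-complete.
   Context: $W_0,W_1,\ldots$ is an acceptable numbering of all r.e. subsets of $\mathbb N$; $L^e_j = \{x : \langle j,x\rangle \in W_e\}$ and $\mathcal L_e = \{L^e_j : j\in\mathbb N\}$. For a family $\mathcal L$ of subsets of $\mathbb N$ and $L\in\mathcal L$: a set $T\subseteq \mathbb N\times\{+,-\}$, with $T^+=\{n:(n,+)\in T\}$, $T^-=\{n:(n,-)\in T\}$, is consistent with $L'$ iff $T^+\subseteq L'$ and $T^-\cap L'=\emptyset$; $T$ is a teaching set for $L$ w.r.t. $\mathcal L$ iff $T$ is consistent with $L$ and with no $L'\in\mathcal L\setminus\{L\}$. $\mathrm{TD}(L,\mathcal L)$ is the size of a smallest teaching set ($\infty$ if none is finite), and $\mathrm{TD}(\mathcal L)=\sup\{\mathrm{TD}(L,\mathcal L): L\in\mathcal L\}$. $\Sigma^0_n$-complete means definable by a $\Sigma^0_n$ formula and every $\Sigma^0_n$ set many-one reduces to it via a recursive function. *)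

theory Defs
  imports Main "HOL-Library.Extended_Nat" "HOL-Library.Nat_Bijection"
begin

section \<open>Recursive functions and r.e. sets\<close>

datatype recf =
    Zero
  | Succ
  | Proj nat
  | Comp recf "recf list"
  | Prim recf recf
  | Mu recf

text \<open>
  \<^term>\<open>evals p xs y\<close> is the graph of the partial recursive function denoted by \<^term>\<open>p\<close>. Arities
  are not tracked by the syntax: for each length \<open>k\<close> of the argument list, a term denotes a
  partial recursive function of \<open>k\<close> arguments (undefined everywhere if the arities do not fit).
\<close>

inductive evals :: "recf \<Rightarrow> nat list \<Rightarrow> nat \<Rightarrow> bool" where
  zero: "evals Zero xs 0"
| succ: "evals Succ (x # xs) (Suc x)"
| proj: "i < length xs \<Longrightarrow> evals (Proj i) xs (xs ! i)"
| comp: "list_all2 (\<lambda>q y. evals q xs y) qs ys \<Longrightarrow> evals p ys z \<Longrightarrow> evals (Comp p qs) xs z"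
| prim_0: "evals p xs y \<Longrightarrow> evals (Prim p q) (0 # xs) y"
| prim_Suc: "evals (Prim p q) (n # xs) r \<Longrightarrow> evals q (n # r # xs) y
    \<Longrightarrow> evals (Prim p q) (Suc n # xs) y"
| mu: "evals p (n # xs) 0 \<Longrightarrow> (\<forall>m<n. \<exists>k. evals p (m # xs) (Suc k)) \<Longrightarrow> evals (Mu p) xs n"

definition recursive_fun :: "(nat \<Rightarrow> nat) \<Rightarrow> bool" where
  "recursive_fun f \<longleftrightarrow> (\<exists>p. \<forall>x y. evals p [x] y \<longleftrightarrow> y = f x)"

definition recursive_rel :: "nat \<Rightarrow> (nat list \<Rightarrow> bool) \<Rightarrow> bool" where
  "recursive_rel k R \<longleftrightarrow>
     (\<exists>p. \<forall>xs y. length xs = k \<longrightarrow> (evals p xs y \<longleftrightarrow> y = (if R xs then 1 else 0)))"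

definition re_set :: "nat set \<Rightarrow> bool" where
  "re_set A \<longleftrightarrow> (\<exists>p. \<forall>x. x \<in> A \<longleftrightarrow> (\<exists>y. evals p [x] y))"

definition uniformly_re :: "(nat \<Rightarrow> nat set) \<Rightarrow> bool" where
  "uniformly_re V \<longleftrightarrow> (\<exists>p. \<forall>e x. x \<in> V e \<longleftrightarrow> (\<exists>y. evals p [e, x] y))"

text \<open>
  A numbering of the r.e. sets is acceptable if it is uniformly r.e. and every uniformly r.e.
  numbering translates into it effectively.
\<close>

definition acceptable_numbering :: "(nat \<Rightarrow> nat set) \<Rightarrow> bool" where
  "acceptable_numbering W \<longleftrightarrow>
     range W = {A. re_set A} \<and> uniformly_re W \<and>
     (\<forall>V. uniformly_re V \<longrightarrow> (\<exists>f. recursive_fun f \<and> (\<forall>e. V e = W (f e))))"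

section \<open>The arithmetical hierarchy\<close>

text \<open>
  A \<open>\<Sigma>\<^sup>0\<^sub>n\<close> formula consists of \<open>n\<close> alternating quantifiers over the natural numbers, beginning
  with an existential one, in front of a recursive matrix \<open>R\<close>; the quantified variables are
  appended to the arguments of the matrix in the order of the prefix.
\<close>

fun ex_prefix :: "nat \<Rightarrow> (nat list \<Rightarrow> bool) \<Rightarrow> nat list \<Rightarrow> bool"
  and all_prefix :: "nat \<Rightarrow> (nat list \<Rightarrow> bool) \<Rightarrow> nat list \<Rightarrow> bool" where
  "ex_prefix 0 R xs \<longleftrightarrow> R xs"
| "ex_prefix (Suc n) R xs \<longleftrightarrow> (\<exists>y. all_prefix n R (xs @ [y]))"
| "all_prefix 0 R xs \<longleftrightarrow> R xs"
| "all_prefix (Suc n) R xs \<longleftrightarrow> (\<forall>y. ex_prefix n R (xs @ [y]))"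

definition Sigma0 :: "nat \<Rightarrow> nat set \<Rightarrow> bool" where
  "Sigma0 n A \<longleftrightarrow> (\<exists>R. recursive_rel (Suc n) R \<and> (\<forall>x. x \<in> A \<longleftrightarrow> ex_prefix n R [x]))"

definition many_one_reducible :: "nat set \<Rightarrow> nat set \<Rightarrow> bool" where
  "many_one_reducible A B \<longleftrightarrow> (\<exists>f. recursive_fun f \<and> (\<forall>x. x \<in> A \<longleftrightarrow> f x \<in> B))"

definition Sigma0_complete :: "nat \<Rightarrow> nat set \<Rightarrow> bool" where
  "Sigma0_complete n A \<longleftrightarrow> Sigma0 n A \<and> (\<forall>B. Sigma0 n B \<longrightarrow> many_one_reducible B A)"

section \<open>Teaching dimension\<close>

datatype sign = Plus | Minus

definition consistent :: "(nat \<times> sign) set \<Rightarrow> nat set \<Rightarrow> bool" where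
  "consistent T L \<longleftrightarrow> {n. (n, Plus) \<in> T} \<subseteq> L \<and> {n. (n, Minus) \<in> T} \<inter> L = {}"

definition teaching_set :: "(nat \<times> sign) set \<Rightarrow> nat set \<Rightarrow> nat set set \<Rightarrow> bool" where
  "teaching_set T L \<L> \<longleftrightarrow> consistent T L \<and> (\<forall>L' \<in> \<L> - {L}. \<not> consistent T L')"

text \<open>The infimum of the empty set in \<^typ>\<open>enat\<close> is \<open>\<infinity>\<close>.\<close>

definition TD :: "nat set \<Rightarrow> nat set set \<Rightarrow> enat" where
  "TD L \<L> = Inf {enat (card T) | T. finite T \<and> teaching_set T L \<L>}"

definition TD_family :: "nat set set \<Rightarrow> enat" where
  "TD_family \<L> = (SUP L \<in> \<L>. TD L \<L>)"

definition lang :: "(nat \<Rightarrow> nat set) \<Rightarrow> nat \<Rightarrow> nat \<Rightarrow> nat set" where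
  "lang W e j = {x. prod_encode (j, x) \<in> W e}"

definition family :: "(nat \<Rightarrow> nat set) \<Rightarrow> nat \<Rightarrow> nat set set" where
  "family W e = {lang W e j | j. True}"

definition I_TD :: "(nat \<Rightarrow> nat set) \<Rightarrow> nat set" where
  "I_TD W = {e. TD_family (family W e) < \<infinity>}"

end

theory Submission imports Defs begin

text \<open>
  For the upper bound, a finite set of at most \<open>k\<close> examples is quantified by its code, and being a
  teaching set for an r.e. language within a uniformly r.e. family is a \<open>\<Pi>\<^sup>0\<^sub>2\<close> property, so that
  finiteness of the teaching dimension takes the form \<open>\<exists>k \<forall>i \<exists>t \<Pi>\<^sup>0\<^sub>2\<close>.

  For hardness let \<open>B = {x. \<exists>a \<forall>b Q(x, a, b)}\<close> with \<open>Q = \<exists>m \<forall>c \<exists>s P\<close>. For each \<open>a\<close> and each sequence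
  \<open>b\<close> there is a gadget with a target \<open>{t\<^sub>0, \<dots>, t\<^sub>a}\<close>. Its competitors miss one \<open>t\<^sub>i\<close> each and carry
  a finite sequence \<open>c\<close>, where \<open>c(a', m)\<close> tries to refute \<open>m\<close> as a witness of \<open>Q(x, a', b(a'))\<close>; an
  element \<open>n(a', m)\<close> outside the target enters every competitor that fails to refute \<open>m\<close>. A correct
  witness \<open>m\<close> for some \<open>a' \<le> a\<close> therefore makes \<open>{(t\<^sub>0, +), (n(a', m), -)}\<close> a teaching set, whereas
  without a witness some competitor escapes every set of at most \<open>a\<close> examples. The \<open>a + 1\<close> positive
  examples always suffice, and a private element makes each competitor teachable by one example.
\<close>

section \<open>Bounded search evaluation\<close>

text \<open>Result 0 means that no value has been found, \<open>Suc y\<close> that the value is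
  \<open>y\<close>. The bound \<open>s\<close> limits only the range of each \<open>Mu\<close>
  search, so the function is total by structural recursion. Inside \<open>Mu\<close>, result 1 is a
  zero of the searched function and a result above 1 a nonzero value.\<close>

fun ev :: "recf \<Rightarrow> nat \<Rightarrow> nat list \<Rightarrow> nat" where
  "ev Zero s xs = 1"
| "ev Succ s xs = (case xs of [] \<Rightarrow> 0 | x # _ \<Rightarrow> Suc (Suc x))"
| "ev (Proj i) s xs = (if i < length xs then Suc (xs ! i) else 0)"
| "ev (Comp p qs) s xs =
     (if \<exists>q\<in>set qs. ev q s xs = 0 then 0 else ev p s (map (\<lambda>q. ev q s xs - 1) qs))"
| "ev (Prim p q) s xs = (case xs of [] \<Rightarrow> 0 | n # xs' \<Rightarrow>
     rec_nat (ev p s xs') (\<lambda>m r. if r = 0 then 0 else ev q s (m # (r - 1) # xs')) n)"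
| "ev (Mu p) s xs = rec_nat 0 (\<lambda>n r. if r \<noteq> 0 then r else
     if ev p s (n # xs) = 1 \<and> (\<forall>m<n. ev p s (m # xs) > 1) then Suc n else 0) s"

text \<open>The recursion keeps its first nonzero result, and at most one \<open>y\<close> meets the
  conditions: of two candidates the smaller has result 1 where the larger demands more.\<close>

lemma ev_Mu_iff:
  "ev (Mu p) s xs = Suc y \<longleftrightarrow> y < s \<and> ev p s (y # xs) = 1 \<and> (\<forall>m<y. ev p s (m # xs) > 1)"
proof -
  define f where "f = (\<lambda>t. rec_nat 0 (\<lambda>n r. if r \<noteq> 0 then r else
     if ev p s (n # xs) = 1 \<and> (\<forall>m<n. ev p s (m # xs) > 1) then Suc n else 0) t)"
  have "f t = Suc y \<longleftrightarrow> y < t \<and> ev p s (y # xs) = 1 \<and> (\<forall>m<y. ev p s (m # xs) > 1)" for t y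
  proof (induction t arbitrary: y)
    case 0
    show ?case by (simp add: f_def)
  next
    case (Suc t)
    have step: "f (Suc t) = (if f t \<noteq> 0 then f t else
      if ev p s (t # xs) = 1 \<and> (\<forall>m<t. ev p s (m # xs) > 1) then Suc t else 0)"
      by (simp add: f_def)
    show ?case
    proof (cases "f t")
      case 0
      then show ?thesis using Suc step by (auto simp: less_Suc_eq)
    next
      case (Suc z)
      with Suc.IH[of z] have z: "z < t" "ev p s (z # xs) = 1" "\<forall>m<z. ev p s (m # xs) > 1"
        by auto
      have "y = z" if "ev p s (y # xs) = 1" "\<forall>m<y. ev p s (m # xs) > 1"
        using that z by (metis less_irrefl linorder_neqE_nat)
      then show ?thesis using z Suc step by auto
    qed
  qed
  from this[of s] show ?thesis by (simp add: f_def)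
qed

text \<open>Lets different bounds be replaced by their maximum, which is how evaluations of subterms
  are combined later.\<close>

lemma ev_mono: "ev p s xs = Suc y \<Longrightarrow> s \<le> t \<Longrightarrow> ev p t xs = Suc y"
proof (induction p arbitrary: xs y)
  case (Comp p qs)
  from Comp.prems have nz: "\<forall>q\<in>set qs. ev q s xs \<noteq> 0"
    and p: "ev p s (map (\<lambda>q. ev q s xs - 1) qs) = Suc y"
    by (auto split: if_splits)
  have "ev q t xs = ev q s xs" if "q \<in> set qs" for q
    using Comp.IH(2)[OF that, of xs "ev q s xs - 1"] nz that Comp.prems(2) by auto
  then have "map (\<lambda>q. ev q t xs - 1) qs = map (\<lambda>q. ev q s xs - 1) qs"
    and "\<forall>q\<in>set qs. ev q t xs \<noteq> 0" using nz by auto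
  then show ?case using Comp.IH(1)[OF p Comp.prems(2)] by (metis ev.simps(4))
next
  case (Prim p q)
  then obtain n xs' where xs: "xs = n # xs'" by (cases xs) auto
  have "ev (Prim p q) s (n # xs') = Suc y \<Longrightarrow> ev (Prim p q) t (n # xs') = Suc y" for n y
  proof (induction n arbitrary: y)
    case 0
    then show ?case using Prim.IH(1) Prim.prems(2) by simp
  next
    case (Suc n)
    then obtain r where r: "ev (Prim p q) s (n # xs') = Suc r" and q: "ev q s (n # r # xs') = Suc y"
      by (cases "ev (Prim p q) s (n # xs')") (auto split: if_splits)
    show ?case using Suc.IH[OF r] Prim.IH(2)[OF q Prim.prems(2)] by simp
  qed
  then show ?case using Prim.prems xs by blast
next
  case (Mu p)
  from Mu.prems(1) have y: "y < s" "ev p s (y # xs) = Suc 0" "\<forall>m<y. ev p s (m # xs) > 1"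
    unfolding ev_Mu_iff by auto
  have "ev p t (m # xs) > 1" if m: "m < y" for m
  proof -
    obtain r where "ev p s (m # xs) = Suc (Suc r)" using y(3)[rule_format, OF m]
      by (auto simp: less_eq_Suc_le le_iff_add)
    from Mu.IH[OF this Mu.prems(2)] show ?thesis by simp
  qed
  then show ?case unfolding ev_Mu_iff using y(1) Mu.IH[OF y(2) Mu.prems(2)] Mu.prems(2) by simp
qed (auto split: list.splits)

lemma ev_sound: "ev p s xs = Suc y \<Longrightarrow> evals p xs y"
proof (induction p arbitrary: xs y)
  case (Comp p qs)
  from Comp.prems have nz: "\<forall>q\<in>set qs. ev q s xs \<noteq> 0"
    and p: "ev p s (map (\<lambda>q. ev q s xs - 1) qs) = Suc y"
    by (auto split: if_splits)
  have "evals q xs (ev q s xs - 1)" if "q \<in> set qs" for q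
    using Comp.IH(2)[OF that] nz that by auto
  then have "list_all2 (\<lambda>q y. evals q xs y) qs (map (\<lambda>q. ev q s xs - 1) qs)"
    by (simp add: list_all2_conv_all_nth)
  then show ?case using Comp.IH(1)[OF p] by (rule evals.comp)
next
  case (Prim p q)
  then obtain n xs' where xs: "xs = n # xs'" by (cases xs) auto
  have "ev (Prim p q) s (n # xs') = Suc y \<Longrightarrow> evals (Prim p q) (n # xs') y" for n y
  proof (induction n arbitrary: y)
    case 0
    then show ?case using Prim.IH(1) by (simp add: evals.prim_0)
  next
    case (Suc n)
    then obtain r where r: "ev (Prim p q) s (n # xs') = Suc r" and q: "ev q s (n # r # xs') = Suc y"
      by (cases "ev (Prim p q) s (n # xs')") (auto split: if_splits)
    show ?case using Suc.IH[OF r] Prim.IH(2)[OF q] by (rule evals.prim_Suc)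
  qed
  then show ?case using Prim.prems xs by blast
next
  case (Mu p)
  from Mu.prems have y: "ev p s (y # xs) = Suc 0" "\<forall>m<y. ev p s (m # xs) > 1"
    unfolding ev_Mu_iff by auto
  have "\<exists>k. evals p (m # xs) (Suc k)" if m: "m < y" for m
  proof -
    obtain r where "ev p s (m # xs) = Suc (Suc r)" using y(2)[rule_format, OF m]
      by (auto simp: less_eq_Suc_le le_iff_add)
    from Mu.IH[OF this] show ?thesis by blast
  qed
  then show ?case using Mu.IH[OF y(1)] by (blast intro: evals.mu)
qed (auto split: list.splits if_splits intro: evals.intros)

lemma ev_complete: "evals p xs y \<Longrightarrow> \<exists>s. ev p s xs = Suc y"
proof (induction rule: evals.induct)
  case (comp xs qs ys p z)
  have "\<exists>s. map (\<lambda>q. ev q s xs) qs = map Suc ys"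
    using comp.IH(1)
  proof (induction rule: list_all2_induct)
    case (Cons q qs y ys)
    then obtain s t where s: "map (\<lambda>q. ev q s xs) qs = map Suc ys" and t: "ev q t xs = Suc y" by blast
    have "map (\<lambda>q. ev q (max s t) xs) qs = map Suc ys"
      using s ev_mono[of _ s xs _ "max s t"] by (auto simp: list_eq_iff_nth_eq)
    then have "map (\<lambda>q. ev q (max s t) xs) (q # qs) = map Suc (y # ys)"
      using ev_mono[OF t, of "max s t"] by simp
    then show ?case by blast
  qed simp
  then obtain s where s: "map (\<lambda>q. ev q s xs) qs = map Suc ys" by blast
  from comp obtain t where t: "ev p t ys = Suc z" by blast
  let ?u = "max s t"
  have u: "map (\<lambda>q. ev q ?u xs) qs = map Suc ys"
    using s ev_mono[of _ s xs _ ?u] by (auto simp: list_eq_iff_nth_eq)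
  then have "\<forall>q\<in>set qs. ev q ?u xs \<noteq> 0"
    by (metis in_set_conv_nth length_map nat.distinct(1) nth_map)
  moreover have "map (\<lambda>q. ev q ?u xs - 1) qs = ys"
    using arg_cong[OF u, of "map (\<lambda>n. n - 1)"] by (simp add: comp_def)
  ultimately have "ev (Comp p qs) ?u xs = Suc z"
    using ev_mono[OF t, of ?u] by (simp del: One_nat_def)
  then show ?case by blast
next
  case (prim_Suc p q n xs r y)
  then obtain s t where "ev (Prim p q) s (n # xs) = Suc r" "ev q t (n # r # xs) = Suc y" by blast
  then have "ev (Prim p q) (max s t) (n # xs) = Suc r" "ev q (max s t) (n # r # xs) = Suc y"
    using ev_mono max.cobounded1 max.cobounded2 by blast+
  then have "ev (Prim p q) (max s t) (Suc n # xs) = Suc y" by simp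
  then show ?case by blast
next
  case (mu p n xs)
  then obtain s0 where s0: "ev p s0 (n # xs) = Suc 0" by blast
  from mu obtain s k where s: "\<forall>m<n. ev p (s m) (m # xs) = Suc (Suc (k m))" by metis
  \<comment> \<open>The bound has to dominate the bounds of all evaluations up to \<open>n\<close>
    and exceed \<open>n\<close> itself, because \<open>Mu\<close> searches strictly below
    it.\<close>
  define t where "t = Suc n + s0 + sum s {..<n}"
  have "ev p t (m # xs) > 1" if "m < n" for m
  proof -
    have "s m \<le> t" using member_le_sum[of m "{..<n}" s] that by (simp add: t_def)
    then show ?thesis using ev_mono[OF s[rule_format, OF that]] by simp
  qed
  moreover have "ev p t (n # xs) = Suc 0" using ev_mono[OF s0, of t] by (simp add: t_def)
  moreover have "n < t" by (simp add: t_def)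
  ultimately have "ev (Mu p) t xs = Suc n" unfolding ev_Mu_iff by simp
  then show ?case by blast
qed (auto split: list.splits)

text \<open>Both derivations are reproduced by \<open>ev\<close> at the larger of their bounds, and
  \<open>ev\<close> is a function.\<close>

lemma evals_deterministic: "evals p xs y \<Longrightarrow> evals p xs z \<Longrightarrow> y = z"
proof -
  assume "evals p xs y" "evals p xs z"
  then obtain s t where "ev p s xs = Suc y" "ev p t xs = Suc z" using ev_complete by blast
  then have "ev p (max s t) xs = Suc y" "ev p (max s t) xs = Suc z"
    using ev_mono max.cobounded1 max.cobounded2 by blast+
  then show ?thesis by simp
qed

lemma evals_iff_ev: "(\<exists>y. evals p xs y) \<longleftrightarrow> (\<exists>s. ev p s xs \<noteq> 0)"
  by (metis ev_sound ev_complete not0_implies_Suc nat.distinct(1))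

section \<open>Closure properties of the recursive functions\<close>

definition env :: "nat list \<Rightarrow> nat \<Rightarrow> nat" where
  "env xs i = (if i < length xs then xs ! i else 0)"

text \<open>The variables of a function are the values of an environment; binding a further variable
  shifts the old ones by one. Stated in this form the closure rules apply by unification.\<close>

definition computable :: "nat \<Rightarrow> ((nat \<Rightarrow> nat) \<Rightarrow> nat) \<Rightarrow> bool" where
  "computable k f \<longleftrightarrow> (\<exists>p. \<forall>xs. length xs = k \<longrightarrow> evals p xs (f (env xs)))"

definition decidable :: "nat \<Rightarrow> ((nat \<Rightarrow> nat) \<Rightarrow> bool) \<Rightarrow> bool" where
  "decidable k P \<longleftrightarrow> computable k (\<lambda>\<sigma>. if P \<sigma> then 1 else 0)"

lemma env_Cons [simp]: "env (x # xs) 0 = x" "env (x # xs) (Suc i) = env xs i"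
  by (simp_all add: env_def)

lemma computable_var: "i < k \<Longrightarrow> computable k (\<lambda>\<sigma>. \<sigma> i)"
  unfolding computable_def by (rule exI[of _ "Proj i"]) (auto simp: env_def intro: evals.proj)

lemma computable_comp:
  assumes "computable (length gs) f" "\<And>g. g \<in> set gs \<Longrightarrow> computable k g"
  shows "computable k (\<lambda>\<sigma>. f (env (map (\<lambda>g. g \<sigma>) gs)))"
proof -
  obtain p where p: "\<And>xs. length xs = length gs \<Longrightarrow> evals p xs (f (env xs))"
    using assms(1) unfolding computable_def by blast
  obtain q where q: "\<And>g xs. g \<in> set gs \<Longrightarrow> length xs = k \<Longrightarrow> evals (q g) xs (g (env xs))"
    using assms(2) unfolding computable_def by metis
  have "evals (Comp p (map q gs)) xs (f (env (map (\<lambda>g. g (env xs)) gs)))" if "length xs = k" for xs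
    by (rule evals.comp[OF _ p]) (auto simp: list_all2_conv_all_nth q that)
  then show ?thesis unfolding computable_def by blast
qed

lemma computable_Suc: "computable k a \<Longrightarrow> computable k (\<lambda>\<sigma>. Suc (a \<sigma>))"
proof -
  have "computable 1 (\<lambda>\<sigma>. Suc (\<sigma> 0))"
    unfolding computable_def
    by (rule exI[of _ Succ]) (auto simp: length_Suc_conv intro: evals.succ)
  then show "computable k a \<Longrightarrow> ?thesis"
    using computable_comp[of "[a]" "\<lambda>\<sigma>. Suc (\<sigma> 0)" k] by simp
qed

lemma computable_const: "computable k (\<lambda>_. c)"
proof (induction c)
  case 0
  show ?case unfolding computable_def by (rule exI[of _ Zero]) (auto intro: evals.zero)
qed (rule computable_Suc)

lemma computable_shift: "computable k a \<Longrightarrow> computable (Suc k) (\<lambda>\<sigma>. a (\<lambda>i. \<sigma> (Suc i)))"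
proof -
  assume "computable k a"
  then obtain p where p: "\<And>xs. length xs = k \<Longrightarrow> evals p xs (a (env xs))"
    unfolding computable_def by blast
  have "evals (Comp p (map (\<lambda>i. Proj (Suc i)) [0..<k])) xs (a (\<lambda>i. env xs (Suc i)))"
    if len: "length xs = Suc k" for xs
  proof -
    obtain x xs' where xs: "xs = x # xs'" "length xs' = k" using len by (auto simp: length_Suc_conv)
    have "evals (Proj (Suc i)) xs (xs' ! i)" if "i < k" for i
      using evals.proj[of "Suc i" xs] xs that by simp
    then show ?thesis
      using p[of xs'] xs by (auto simp: list_all2_conv_all_nth intro!: evals.comp[of _ _ xs'])
  qed
  then show ?thesis unfolding computable_def by blast
qed

text \<open>Inserts a dummy variable at position 1. The body of a bounded search is moved past the
  accumulator of the primitive recursion this way.\<close>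

lemma computable_skip:
  assumes "computable (Suc k) (\<lambda>\<sigma>. f (\<sigma> 0) (\<lambda>i. \<sigma> (Suc i)))"
  shows "computable (Suc (Suc k)) (\<lambda>\<sigma>. f (\<sigma> 0) (\<lambda>i. \<sigma> (Suc (Suc i))))"
proof -
  let ?gs = "(\<lambda>\<sigma>. \<sigma> 0) # map (\<lambda>i \<sigma>. \<sigma> (Suc (Suc i))) [0..<k]"
  have "computable (Suc (Suc k)) (\<lambda>\<sigma>. f (\<sigma> 0) (env (map (\<lambda>i. \<sigma> (Suc (Suc i))) [0..<k])))"
    using computable_comp[of ?gs "\<lambda>\<sigma>. f (\<sigma> 0) (\<lambda>i. \<sigma> (Suc i))" "Suc (Suc k)"] assms
    by (fastforce simp: comp_def intro: computable_var)
  moreover have "env (map (\<lambda>i. env xs (Suc (Suc i))) [0..<k]) = (\<lambda>i. env xs (Suc (Suc i)))"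
    if "length xs = Suc (Suc k)" for xs
    using that by (auto simp: env_def)
  ultimately show ?thesis unfolding computable_def by auto
qed

lemma computable_rec:
  assumes "computable k a" "computable (Suc (Suc k)) (\<lambda>\<sigma>. b (\<sigma> 0) (\<sigma> 1) (\<lambda>i. \<sigma> (Suc (Suc i))))"
    "computable k c"
  shows "computable k (\<lambda>\<sigma>. rec_nat (a \<sigma>) (\<lambda>n r. b n r \<sigma>) (c \<sigma>))"
proof -
  obtain p where p: "\<And>xs. length xs = k \<Longrightarrow> evals p xs (a (env xs))"
    using assms(1) unfolding computable_def by blast
  obtain q where q: "\<And>xs. length xs = Suc (Suc k) \<Longrightarrow>
      evals q xs (b (env xs 0) (env xs 1) (\<lambda>i. env xs (Suc (Suc i))))"
    using assms(2) unfolding computable_def by blast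
  obtain r where r: "\<And>xs. length xs = k \<Longrightarrow> evals r xs (c (env xs))"
    using assms(3) unfolding computable_def by blast
  have "evals (Comp (Prim p q) (r # map Proj [0..<k])) xs
      (rec_nat (a (env xs)) (\<lambda>n r. b n r (env xs)) (c (env xs)))" if len: "length xs = k" for xs
  proof (rule evals.comp)
    show "list_all2 (\<lambda>q y. evals q xs y) (r # map Proj [0..<k]) (c (env xs) # xs)"
      using r len by (auto simp: list_all2_conv_all_nth nth_Cons split: nat.split intro: evals.proj)
    show "evals (Prim p q) (n # xs) (rec_nat (a (env xs)) (\<lambda>n r. b n r (env xs)) n)" for n
    proof (induction n)
      case 0
      show ?case using p len by (simp add: evals.prim_0)
    next
      case (Suc n)
      have "evals q (n # m # xs) (b n m (env xs))" for m
        using q[of "n # m # xs"] len by simp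
      then show ?case using evals.prim_Suc[OF Suc] by simp
    qed
  qed
  then show ?thesis unfolding computable_def by blast
qed

lemma computable_apply1:
  "computable 1 (\<lambda>\<sigma>. F (\<sigma> 0)) \<Longrightarrow> computable k a \<Longrightarrow> computable k (\<lambda>\<sigma>. F (a \<sigma>))"
  using computable_comp[of "[a]" "\<lambda>\<sigma>. F (\<sigma> 0)" k] by simp

section \<open>Arithmetic, propositional connectives, bounded quantifiers and minimisation\<close>

named_theorems comp_intros

lemmas [comp_intros] = computable_var computable_Suc computable_const computable_rec

lemma computable_add [comp_intros]:
  "computable k a \<Longrightarrow> computable k b \<Longrightarrow> computable k (\<lambda>\<sigma>. a \<sigma> + b \<sigma>)"
proof -
  have eq: "x + y = rec_nat x (\<lambda>n r. Suc r) y" for x y :: nat by (induction y) auto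
  show "computable k a \<Longrightarrow> computable k b \<Longrightarrow> ?thesis" unfolding eq by (intro comp_intros) auto
qed

lemma computable_diff [comp_intros]:
  "computable k a \<Longrightarrow> computable k b \<Longrightarrow> computable k (\<lambda>\<sigma>. a \<sigma> - b \<sigma>)"
proof -
  have pred: "rec_nat 0 (\<lambda>n r. n) r = r - 1" for r :: nat by (cases r) auto
  have eq: "rec_nat x (\<lambda>n r. rec_nat 0 (\<lambda>n r. n) r) y = x - y" for x y :: nat
    unfolding pred by (induction y) auto
  show "computable k a \<Longrightarrow> computable k b \<Longrightarrow> ?thesis"
    unfolding eq[symmetric] by (intro comp_intros) auto
qed

lemma computable_if [comp_intros]:
  "decidable k P \<Longrightarrow> computable k a \<Longrightarrow> computable k b \<Longrightarrow>
    computable k (\<lambda>\<sigma>. if P \<sigma> then a \<sigma> else b \<sigma>)"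
proof -
  \<comment> \<open>A conditional is a recursion over the 0/1 value of its condition, with a step
    that ignores counter and accumulator.\<close>
  have eq: "(if P \<sigma> then a \<sigma> else b \<sigma>) =
      rec_nat (b \<sigma>) (\<lambda>_ _. a \<sigma>) (if P \<sigma> then 1 else 0)" for \<sigma> by simp
  have "computable (Suc (Suc k)) (\<lambda>\<sigma>. a (\<lambda>i. \<sigma> (Suc (Suc i))))" if "computable k a"
    using computable_shift[OF computable_shift[OF that]] .
  then show "decidable k P \<Longrightarrow> computable k a \<Longrightarrow> computable k b \<Longrightarrow> ?thesis"
    unfolding eq decidable_def by (intro computable_rec)
qed

lemma decidable_not [comp_intros]: "decidable k P \<Longrightarrow> decidable k (\<lambda>\<sigma>. \<not> P \<sigma>)"
proof -
  have eq: "(if \<not> P \<sigma> then 1 else 0) = (if P \<sigma> then 0 else 1 :: nat)" for \<sigma> by simp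
  show "decidable k P \<Longrightarrow> ?thesis"
    unfolding decidable_def[of k "\<lambda>\<sigma>. \<not> P \<sigma>"] eq by (intro comp_intros)
qed

lemma decidable_conj [comp_intros]:
  "decidable k P \<Longrightarrow> decidable k Q \<Longrightarrow> decidable k (\<lambda>\<sigma>. P \<sigma> \<and> Q \<sigma>)"
proof -
  have eq: "(if P \<sigma> \<and> Q \<sigma> then 1 else 0) = (if P \<sigma> then if Q \<sigma> then 1 else 0 else 0 :: nat)" for \<sigma>
    by simp
  show "decidable k P \<Longrightarrow> decidable k Q \<Longrightarrow> ?thesis"
    unfolding decidable_def[of k "\<lambda>\<sigma>. P \<sigma> \<and> Q \<sigma>"] eq by (intro comp_intros)
qed

lemma decidable_disj [comp_intros]:
  "decidable k P \<Longrightarrow> decidable k Q \<Longrightarrow> decidable k (\<lambda>\<sigma>. P \<sigma> \<or> Q \<sigma>)"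
  using decidable_not[OF decidable_conj[OF decidable_not decidable_not]] by simp

lemma decidable_imp [comp_intros]:
  "decidable k P \<Longrightarrow> decidable k Q \<Longrightarrow> decidable k (\<lambda>\<sigma>. P \<sigma> \<longrightarrow> Q \<sigma>)"
  unfolding imp_conv_disj by (intro comp_intros)

lemma decidable_le [comp_intros]:
  "computable k a \<Longrightarrow> computable k b \<Longrightarrow> decidable k (\<lambda>\<sigma>. a \<sigma> \<le> b \<sigma>)"
proof -
  have eq: "(if x \<le> y then 1 else 0) = 1 - (x - y)" for x y :: nat by (cases "x \<le> y") auto
  show "computable k a \<Longrightarrow> computable k b \<Longrightarrow> ?thesis"
    unfolding decidable_def eq by (intro comp_intros)
qed

lemma decidable_less [comp_intros]:
  "computable k a \<Longrightarrow> computable k b \<Longrightarrow> decidable k (\<lambda>\<sigma>. a \<sigma> < b \<sigma>)"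
  unfolding not_le[symmetric] by (intro comp_intros)

lemma decidable_eq [comp_intros]:
  "computable k a \<Longrightarrow> computable k b \<Longrightarrow> decidable k (\<lambda>\<sigma>. a \<sigma> = b \<sigma>)"
  unfolding order.eq_iff by (intro comp_intros)

lemma decidable_bex [comp_intros]:
  assumes "decidable (Suc k) (\<lambda>\<sigma>. P (\<sigma> 0) (\<lambda>i. \<sigma> (Suc i)))" "computable k b"
  shows "decidable k (\<lambda>\<sigma>. \<exists>n<b \<sigma>. P n \<sigma>)"
proof -
  have eq: "(if \<exists>n<m. P n \<sigma> then 1 else 0) = rec_nat 0 (\<lambda>n r. if P n \<sigma> then 1 else r) m" for m \<sigma>
  proof (induction m)
    case (Suc m)
    have "(\<exists>n<Suc m. P n \<sigma>) \<longleftrightarrow> P m \<sigma> \<or> (\<exists>n<m. P n \<sigma>)" by (auto simp: less_Suc_eq)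
    then show ?case using Suc by simp
  qed simp
  have "decidable (Suc (Suc k)) (\<lambda>\<sigma>. P (\<sigma> 0) (\<lambda>i. \<sigma> (Suc (Suc i))))"
    using computable_skip[of k "\<lambda>n \<sigma>. if P n \<sigma> then 1 else 0"] assms(1)
    unfolding decidable_def .
  then show ?thesis
    unfolding decidable_def[of k] eq using assms(2) by (intro comp_intros) auto
qed

lemma decidable_ball [comp_intros]:
  assumes "decidable (Suc k) (\<lambda>\<sigma>. P (\<sigma> 0) (\<lambda>i. \<sigma> (Suc i)))" "computable k b"
  shows "decidable k (\<lambda>\<sigma>. \<forall>n<b \<sigma>. P n \<sigma>)"
  using decidable_not[OF decidable_bex[OF decidable_not[OF assms(1)] assms(2)]] by simp

text \<open>\<open>Mu\<close> looks for zeros, so the proof encodes truth as 0; the second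
  assumption makes the search succeed in every environment.\<close>

lemma computable_Least:
  assumes "decidable (Suc k) (\<lambda>\<sigma>. P (\<sigma> 0) (\<lambda>i. \<sigma> (Suc i)))" "\<And>\<sigma>. \<exists>n. P n \<sigma>"
  shows "computable k (\<lambda>\<sigma>. LEAST n. P n \<sigma>)"
proof -
  have "computable (Suc k) (\<lambda>\<sigma>. if P (\<sigma> 0) (\<lambda>i. \<sigma> (Suc i)) then 0 else 1)"
    using assms(1) by (intro comp_intros)
  then obtain p where p: "\<And>xs. length xs = Suc k \<Longrightarrow>
      evals p xs (if P (env xs 0) (\<lambda>i. env xs (Suc i)) then 0 else 1)"
    unfolding computable_def by blast
  have "evals (Mu p) xs (LEAST n. P n (env xs))" if len: "length xs = k" for xs
  proof (rule evals.mu)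
    have q: "evals p (n # xs) (if P n (env xs) then 0 else 1)" for n
      using p[of "n # xs"] len by simp
    show "evals p ((LEAST n. P n (env xs)) # xs) 0"
      using q[of "LEAST n. P n (env xs)"] LeastI_ex[OF assms(2), of "env xs"] by simp
    show "\<forall>m<LEAST n. P n (env xs). \<exists>k. evals p (m # xs) (Suc k)"
      using q not_less_Least by (metis One_nat_def)
  qed
  then show ?thesis unfolding computable_def by blast
qed

section \<open>Pairing, projections and coded sequences\<close>

lemma computable_prod_encode [comp_intros]:
  "computable k a \<Longrightarrow> computable k b \<Longrightarrow> computable k (\<lambda>\<sigma>. prod_encode (a \<sigma>, b \<sigma>))"
proof -
  have eq: "triangle n = rec_nat 0 (\<lambda>n r. r + Suc n) n" for n by (induction n) auto
  show "computable k a \<Longrightarrow> computable k b \<Longrightarrow> ?thesis"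
    unfolding prod_encode_def prod.case eq by (intro comp_intros) auto
qed

definition pfst :: "nat \<Rightarrow> nat" where "pfst z = fst (prod_decode z)"
definition psnd :: "nat \<Rightarrow> nat" where "psnd z = snd (prod_decode z)"

lemma pfst_psnd [simp]: "pfst (prod_encode (a, b)) = a" "psnd (prod_encode (a, b)) = b"
  by (simp_all add: pfst_def psnd_def)

lemma prod_encode_pfst_psnd [simp]: "prod_encode (pfst z, psnd z) = z"
  by (simp add: pfst_def psnd_def)

text \<open>Pairing is inverted by minimisation over the wanted component; the other one is searched
  below \<open>Suc z\<close>, as no component exceeds its code.\<close>

lemma computable_pfst [comp_intros]: "computable k a \<Longrightarrow> computable k (\<lambda>\<sigma>. pfst (a \<sigma>))"
proof -
  have ex: "\<exists>n<Suc z. prod_encode (pfst z, n) = z" for z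
    by (rule exI[of _ "psnd z"]) (metis le_imp_less_Suc le_prod_encode_2 prod_encode_pfst_psnd)
  have eq: "pfst z = (LEAST m. \<exists>n<Suc z. prod_encode (m, n) = z)" for z
    by (rule Least_equality[symmetric]) (use ex in auto)
  have "computable 1 (\<lambda>\<sigma>. pfst (\<sigma> 0))"
    unfolding eq
  proof (rule computable_Least)
    show "\<exists>m. \<exists>n<Suc (\<sigma> 0). prod_encode (m, n) = \<sigma> 0" for \<sigma> :: "nat \<Rightarrow> nat"
      using ex by blast
  qed (intro comp_intros; simp)
  then show "computable k a \<Longrightarrow> ?thesis" by (rule computable_apply1)
qed

lemma computable_psnd [comp_intros]: "computable k a \<Longrightarrow> computable k (\<lambda>\<sigma>. psnd (a \<sigma>))"
proof -
  have ex: "\<exists>m<Suc z. prod_encode (m, psnd z) = z" for z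
    by (rule exI[of _ "pfst z"]) (metis le_imp_less_Suc le_prod_encode_1 prod_encode_pfst_psnd)
  have eq: "psnd z = (LEAST n. \<exists>m<Suc z. prod_encode (m, n) = z)" for z
    by (rule Least_equality[symmetric]) (use ex in auto)
  have "computable 1 (\<lambda>\<sigma>. psnd (\<sigma> 0))"
    unfolding eq
  proof (rule computable_Least)
    show "\<exists>n. \<exists>m<Suc (\<sigma> 0). prod_encode (m, n) = \<sigma> 0" for \<sigma> :: "nat \<Rightarrow> nat"
      using ex by blast
  qed (intro comp_intros; simp)
  then show "computable k a \<Longrightarrow> ?thesis" by (rule computable_apply1)
qed

text \<open>Iterated pairing lets every number code an infinite sequence, so decoding needs no length.\<close>

definition seq_nth :: "nat \<Rightarrow> nat \<Rightarrow> nat" where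
  "seq_nth t i = pfst (rec_nat t (\<lambda>_. psnd) i)"

lemma computable_seq_nth [comp_intros]:
  "computable k a \<Longrightarrow> computable k b \<Longrightarrow> computable k (\<lambda>\<sigma>. seq_nth (a \<sigma>) (b \<sigma>))"
  unfolding seq_nth_def by (intro comp_intros) auto

lemma seq_nth_prod_encode [simp]:
  "seq_nth (prod_encode (x, t)) 0 = x" "seq_nth (prod_encode (x, t)) (Suc i) = seq_nth t i"
proof -
  have "rec_nat (prod_encode (x, t)) (\<lambda>_. psnd) (Suc i) = rec_nat t (\<lambda>_. psnd) i"
    by (induction i) auto
  then show "seq_nth (prod_encode (x, t)) (Suc i) = seq_nth t i" by (simp add: seq_nth_def)
qed (simp add: seq_nth_def)

lemma ex_seq_nth: "\<exists>t. \<forall>i<n. seq_nth t i = f i"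
proof (induction n arbitrary: f)
  case (Suc n)
  from Suc[of "\<lambda>i. f (Suc i)"] obtain t where "\<forall>i<n. seq_nth t i = f (Suc i)" by blast
  then have "\<forall>i<Suc n. seq_nth (prod_encode (f 0, t)) i = f i" by (auto simp: less_Suc_eq_0_disj)
  then show ?case by blast
qed simp

section \<open>Computability of the bounded evaluator\<close>

lemma decidable_Bex_set:
  "(\<And>q. q \<in> set qs \<Longrightarrow> decidable k (P q)) \<Longrightarrow> decidable k (\<lambda>\<sigma>. \<exists>q\<in>set qs. P q \<sigma>)"
proof (induction qs)
  case Nil
  show ?case by (simp add: decidable_def computable_const)
qed (auto intro: decidable_disj)

text \<open>\<open>p\<close> is fixed, so the induction follows its structure. \<open>k\<close> and
  \<open>as\<close> must vary, since \<open>Prim\<close> and \<open>Mu\<close> evaluate their parts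
  under additional bound variables and \<open>Comp\<close> evaluates \<open>p\<close> on new
  arguments.\<close>

lemma computable_ev:
  assumes "computable k s" "\<And>a. a \<in> set as \<Longrightarrow> computable k a"
  shows "computable k (\<lambda>\<sigma>. ev p (s \<sigma>) (map (\<lambda>a. a \<sigma>) as))"
  using assms
proof (induction p arbitrary: k s as)
  case Zero
  show ?case by (simp add: computable_const)
next
  case Succ
  then show ?case by (cases as) (auto intro!: comp_intros)
next
  case (Proj i)
  then show ?case
    by (cases "i < length as") (auto intro!: computable_Suc computable_const)
next
  case (Comp p qs)
  have q: "computable k (\<lambda>\<sigma>. ev q (s \<sigma>) (map (\<lambda>a. a \<sigma>) as))" if "q \<in> set qs" for q
    using Comp that by blast
  have "computable k (\<lambda>\<sigma>. ev p (s \<sigma>) (map (\<lambda>a. a \<sigma>)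
      (map (\<lambda>q \<sigma>. ev q (s \<sigma>) (map (\<lambda>a. a \<sigma>) as) - 1) qs)))"
    using q Comp.prems(1) by (intro Comp.IH(1)) (auto intro: computable_diff computable_const)
  moreover have "decidable k (\<lambda>\<sigma>. \<exists>q\<in>set qs. ev q (s \<sigma>) (map (\<lambda>a. a \<sigma>) as) = 0)"
    using q by (intro decidable_Bex_set comp_intros)
  ultimately show ?case
    unfolding ev.simps by (intro computable_if computable_const) (simp_all add: comp_def)
next
  case (Prim p q)
  show ?case
  proof (cases as)
    case Nil
    then show ?thesis by (simp add: computable_const)
  next
    case (Cons c bs)
    let ?sh = "\<lambda>a \<sigma>. a (\<lambda>i. \<sigma> (Suc (Suc i)))"
    have sh: "computable (Suc (Suc k)) (?sh a)" if "computable k a" for a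
      using computable_shift[OF computable_shift[OF that]] .
    have "computable (Suc (Suc k)) (\<lambda>\<sigma>. ev q (?sh s \<sigma>)
        (map (\<lambda>a. a \<sigma>) ((\<lambda>\<sigma>. \<sigma> 0) # (\<lambda>\<sigma>. \<sigma> 1 - 1) # map ?sh bs)))"
      using Prim.prems Cons by (intro Prim.IH(2) sh) (auto intro!: comp_intros sh)
    then have "computable (Suc (Suc k)) (\<lambda>\<sigma>. ev q (?sh s \<sigma>)
        (\<sigma> 0 # (\<sigma> 1 - 1) # map (\<lambda>a. a (\<lambda>i. \<sigma> (Suc (Suc i)))) bs))"
      by (simp add: comp_def)
    moreover have "computable k (\<lambda>\<sigma>. ev p (s \<sigma>) (map (\<lambda>a. a \<sigma>) bs))"
      using Prim.prems Cons by (intro Prim.IH(1)) auto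
    ultimately show ?thesis
      unfolding Cons ev.simps list.map list.case using Prim.prems Cons
      by (intro comp_intros) auto
  qed
next
  case (Mu p)
  let ?E = "\<lambda>n \<sigma>. ev p (s \<sigma>) (n # map (\<lambda>a. a \<sigma>) as)"
  have "computable (Suc k) (\<lambda>\<sigma>. ev p (s (\<lambda>i. \<sigma> (Suc i)))
      (map (\<lambda>a. a \<sigma>) ((\<lambda>\<sigma>. \<sigma> 0) # map (\<lambda>a \<sigma>. a (\<lambda>i. \<sigma> (Suc i))) as)))"
    using Mu.prems by (intro Mu.IH) (auto intro: computable_shift computable_var)
  then have "computable (Suc k) (\<lambda>\<sigma>. ?E (\<sigma> 0) (\<lambda>i. \<sigma> (Suc i)))"
    by (simp add: comp_def)
  \<comment> \<open>\<open>E2\<close> serves the evaluation under counter and accumulator of the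
    recursion, \<open>E3\<close> the one under the further variable of the bounded
    quantifier.\<close>
  note E2 = computable_skip[of k ?E, OF this]
  note E3 = computable_skip[of "Suc k" "\<lambda>n \<sigma>. ?E n (\<lambda>i. \<sigma> (Suc i))", OF E2]
  show ?case
    unfolding ev.simps by (intro comp_intros) (simp_all add: E2 E3 Mu.prems)
qed

section \<open>Recursive relations and uniformly r.e. families\<close>

lemma map_env [simp]: "length xs = k \<Longrightarrow> map (env xs) [0..<k] = xs"
  by (auto simp: env_def intro: nth_equalityI)

text \<open>Determinism turns the single computed value into the equivalence that
  \<open>recursive_rel\<close> demands.\<close>

lemma recursive_rel_iff: "recursive_rel k R \<longleftrightarrow> decidable k (\<lambda>\<sigma>. R (map \<sigma> [0..<k]))"
proof
  assume "recursive_rel k R"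
  then obtain p where "\<And>xs y. length xs = k \<Longrightarrow> evals p xs y \<longleftrightarrow> y = (if R xs then 1 else 0)"
    unfolding recursive_rel_def by blast
  then show "decidable k (\<lambda>\<sigma>. R (map \<sigma> [0..<k]))"
    unfolding decidable_def computable_def by (intro exI[of _ p]) simp
next
  assume "decidable k (\<lambda>\<sigma>. R (map \<sigma> [0..<k]))"
  then obtain p where "\<And>xs. length xs = k \<Longrightarrow> evals p xs (if R xs then 1 else 0)"
    unfolding decidable_def computable_def by auto
  then show "recursive_rel k R"
    unfolding recursive_rel_def using evals_deterministic by (intro exI[of _ p]) blast
qed

lemma decidable_recursive_rel:
  assumes "recursive_rel (length gs) R" "\<And>g. g \<in> set gs \<Longrightarrow> computable k g"
  shows "decidable k (\<lambda>\<sigma>. R (map (\<lambda>g. g \<sigma>) gs))"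
  using computable_comp[OF assms(1)[unfolded recursive_rel_iff decidable_def] assms(2)]
  by (simp add: decidable_def)

lemma decidable_apply3:
  assumes "decidable 3 (\<lambda>\<sigma>. P (\<sigma> 0) (\<sigma> 1) (\<sigma> 2))"
    "computable k a" "computable k b" "computable k c"
  shows "decidable k (\<lambda>\<sigma>. P (a \<sigma>) (b \<sigma>) (c \<sigma>))"
  using computable_comp[of "[a, b, c]" "\<lambda>\<sigma>. if P (\<sigma> 0) (\<sigma> 1) (\<sigma> 2) then 1 else 0" k] assms
  by (fastforce simp: decidable_def numeral_eq_Suc)

text \<open>\<open>S s e x\<close> says that the enumerating program yields a value on
  \<open>[e, x]\<close> with search bound \<open>s\<close>; it is decidable by
  \<open>computable_ev\<close> and monotone by \<open>ev_mono\<close>.\<close>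

lemma uniformly_re_approximation:
  assumes "uniformly_re W"
  obtains S where "decidable 3 (\<lambda>\<sigma>. S (\<sigma> 0) (\<sigma> 1) (\<sigma> 2))"
    "\<And>e x. x \<in> W e \<longleftrightarrow> (\<exists>s. S s e x)" "\<And>s t e x. S s e x \<Longrightarrow> s \<le> t \<Longrightarrow> S t e x"
proof -
  obtain p where p: "\<And>e x. x \<in> W e \<longleftrightarrow> (\<exists>y. evals p [e, x] y)"
    using assms unfolding uniformly_re_def by blast
  have "computable 3 (\<lambda>\<sigma>. ev p (\<sigma> 0) (map (\<lambda>a. a \<sigma>) [\<lambda>\<sigma>. \<sigma> 1, \<lambda>\<sigma>. \<sigma> 2]))"
    by (rule computable_ev) (auto intro!: computable_var)
  then have "decidable 3 (\<lambda>\<sigma>. ev p (\<sigma> 0) [\<sigma> 1, \<sigma> 2] \<noteq> 0)"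
    by (intro decidable_not decidable_eq computable_const) simp
  moreover have "ev p t [e, x] \<noteq> 0" if nz: "ev p s [e, x] \<noteq> 0" and "s \<le> t" for s t e x
  proof -
    obtain y where "ev p s [e, x] = Suc y" using nz by (cases "ev p s [e, x]") auto
    from ev_mono[OF this that(2)] show ?thesis by simp
  qed
  ultimately show thesis
    using p unfolding evals_iff_ev by (intro that[of "\<lambda>s e x. ev p s [e, x] \<noteq> 0"])
qed

text \<open>Converse of the approximation: a program looks for a stage by \<open>Mu\<close>, with 0
  marking a stage that succeeds.\<close>

lemma uniformly_re_ex:
  assumes "decidable 3 (\<lambda>\<sigma>. S (\<sigma> 0) (\<sigma> 1) (\<sigma> 2))"
  shows "uniformly_re (\<lambda>e. {x. \<exists>s. S s e x})"
proof -
  have "computable 3 (\<lambda>\<sigma>. if S (\<sigma> 0) (\<sigma> 1) (\<sigma> 2) then 0 else 1)"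
    using assms by (intro computable_if computable_const)
  then obtain p where "\<And>xs. length xs = 3 \<Longrightarrow>
      evals p xs (if S (env xs 0) (env xs 1) (env xs 2) then 0 else 1)"
    unfolding computable_def by blast
  from this[of "[s, e, x]" for s e x]
  have p: "evals p [s, e, x] (if S s e x then 0 else 1)" for s e x
    by (simp add: numeral_2_eq_2)
  have "(\<exists>s. S s e x) \<longleftrightarrow> (\<exists>y. evals (Mu p) [e, x] y)" for e x
  proof
    assume ex: "\<exists>s. S s e x"
    have "evals (Mu p) [e, x] (LEAST s. S s e x)"
    proof (rule evals.mu)
      show "evals p ((LEAST s. S s e x) # [e, x]) 0"
        using p[of "LEAST s. S s e x" e x] LeastI_ex[OF ex] by simp
      show "\<forall>m<LEAST s. S s e x. \<exists>k. evals p (m # [e, x]) (Suc k)"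
        using p not_less_Least by (metis One_nat_def)
    qed
    then show "\<exists>y. evals (Mu p) [e, x] y" ..
  next
    assume "\<exists>y. evals (Mu p) [e, x] y"
    then obtain y where "evals (Mu p) [e, x] y" ..
    then have "evals p [y, e, x] 0" by cases
    from evals_deterministic[OF this p[of y e x]] have "S y e x" by (simp split: if_splits)
    then show "\<exists>s. S s e x" ..
  qed
  then show ?thesis unfolding uniformly_re_def by (intro exI[of _ "Mu p"]) blast
qed

section \<open>The upper bound\<close>

text \<open>A nonempty set of sizes contains its infimum because \<open>enat\<close> is
  well-ordered; for an empty set the infimum is infinite and lies below no
  \<open>enat k\<close>.\<close>

lemma TD_le_iff:
  "TD L \<L> \<le> enat k \<longleftrightarrow> (\<exists>T. finite T \<and> card T \<le> k \<and> teaching_set T L \<L>)"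
proof
  let ?A = "{enat (card T) | T. finite T \<and> teaching_set T L \<L>}"
  assume le: "TD L \<L> \<le> enat k"
  have "?A \<noteq> {}"
  proof
    assume "?A = {}"
    then have "TD L \<L> = \<infinity>" unfolding TD_def by (simp only: Inf_empty top_enat_def)
    with le show False by simp
  qed
  then have "TD L \<L> \<in> ?A"
    unfolding TD_def Inf_enat_def by (metis (mono_tags, lifting) LeastI ex_in_conv)
  then show "\<exists>T. finite T \<and> card T \<le> k \<and> teaching_set T L \<L>" using le by auto
next
  assume "\<exists>T. finite T \<and> card T \<le> k \<and> teaching_set T L \<L>"
  then show "TD L \<L> \<le> enat k" unfolding TD_def by (auto intro!: Inf_lower2)
qed

lemma TD_family_finite_iff:
  "TD_family \<L> < \<infinity> \<longleftrightarrow> (\<exists>k. \<forall>L\<in>\<L>. \<exists>T. finite T \<and> card T \<le> k \<and> teaching_set T L \<L>)"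
proof -
  have "x < \<infinity> \<longleftrightarrow> (\<exists>k. x \<le> enat k)" for x by (cases x) auto
  then show ?thesis by (simp only: TD_family_def SUP_le_iff TD_le_iff)
qed

text \<open>Entries whose first component is neither 0 nor 1 stand for no example, so that a sequence of
  length \<open>k\<close> can code fewer than \<open>k\<close> examples.\<close>

definition coded_examples :: "nat \<Rightarrow> nat \<Rightarrow> (nat \<times> sign) set" where
  "coded_examples k t =
     {(n, s). \<exists>i<k. seq_nth t i = prod_encode (case s of Plus \<Rightarrow> 0 | Minus \<Rightarrow> 1, n)}"

lemma coded_examples_finite: "finite (coded_examples k t)" "card (coded_examples k t) \<le> k"
proof -
  let ?f = "\<lambda>i. (psnd (seq_nth t i), if pfst (seq_nth t i) = 0 then Plus else Minus)"
  have sub: "coded_examples k t \<subseteq> ?f ` {..<k}"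
  proof
    fix x
    assume "x \<in> coded_examples k t"
    then obtain n s i where "x = (n, s)" "i < k"
      "seq_nth t i = prod_encode (case s of Plus \<Rightarrow> 0 | Minus \<Rightarrow> 1, n)"
      by (auto simp: coded_examples_def)
    then have "x = ?f i" "i < k" by (cases s; simp)+
    then show "x \<in> ?f ` {..<k}" by blast
  qed
  then show "finite (coded_examples k t)" by (rule finite_subset) simp
  show "card (coded_examples k t) \<le> k" using surj_card_le[OF _ sub] by simp
qed

lemma ex_coded_examples:
  assumes "finite T" "card T \<le> k"
  shows "\<exists>t. coded_examples k t = T"
proof -
  define c where "c = (\<lambda>x. prod_encode (case snd x of Plus \<Rightarrow> 0 | Minus \<Rightarrow> 1, fst x))"
  obtain h where h: "bij_betw h {0..<card T} T"
    using ex_bij_betw_nat_finite[OF assms(1)] by blast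
  obtain t where t: "\<forall>i<k. seq_nth t i = (if i < card T then c (h i) else prod_encode (2, 0))"
    using ex_seq_nth[of k "\<lambda>i. if i < card T then c (h i) else prod_encode (2, 0)"] by blast
  have inj: "c x = c y \<longleftrightarrow> x = y" for x y
    by (cases "snd x"; cases "snd y") (auto simp: c_def prod_eq_iff)
  have ne: "c x \<noteq> prod_encode (2, 0)" for x by (cases "snd x") (auto simp: c_def)
  have "x \<in> coded_examples k t \<longleftrightarrow> x \<in> T" for x
  proof -
    have "x \<in> coded_examples k t \<longleftrightarrow> (\<exists>i<k. seq_nth t i = c x)"
      by (cases x) (simp add: coded_examples_def c_def)
    also have "\<dots> \<longleftrightarrow> (\<exists>i<k. i < card T \<and> h i = x)"
    proof (intro ex_cong1 conj_cong refl)
      fix i assume "i < k"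
      then have "seq_nth t i = (if i < card T then c (h i) else prod_encode (2, 0))" using t by blast
      then show "seq_nth t i = c x \<longleftrightarrow> i < card T \<and> h i = x"
        using ne[of x] inj[of "h i" x] by (simp split: if_splits)
    qed
    also have "\<dots> \<longleftrightarrow> x \<in> h ` {0..<card T}"
      using order_less_le_trans[OF _ assms(2)] by fastforce
    finally show ?thesis using bij_betw_imp_surj_on[OF h] by simp
  qed
  then show ?thesis by blast
qed

lemma consistent_coded_examples:
  "consistent (coded_examples k t) L \<longleftrightarrow>
    (\<forall>n<k. (pfst (seq_nth t n) = 0 \<longrightarrow> psnd (seq_nth t n) \<in> L) \<and>
           (pfst (seq_nth t n) = 1 \<longrightarrow> psnd (seq_nth t n) \<notin> L))" (is "_ \<longleftrightarrow> ?r")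
proof -
  have *: "v = prod_encode (a, n) \<longleftrightarrow> pfst v = a \<and> psnd v = n" for v a n
    by (metis pfst_psnd prod_encode_pfst_psnd)
  show ?thesis
    unfolding consistent_def coded_examples_def * by auto
qed

text \<open>Stage \<open>s\<close> is to be quantified universally and \<open>s'\<close>
  existentially after it. Membership is claimed at \<open>s'\<close> and non-membership at
  \<open>s\<close>, so that a missing positive example, a present negative one and agreement on
  \<open>x\<close> all fit under one such pair of quantifiers.\<close>

definition teaching_matrix ::
  "(nat \<Rightarrow> nat \<Rightarrow> nat \<Rightarrow> bool) \<Rightarrow> nat \<Rightarrow> nat \<Rightarrow> nat \<Rightarrow> nat \<Rightarrow> nat \<Rightarrow> nat \<Rightarrow> nat \<Rightarrow> bool" where
  "teaching_matrix S k i t j x s s' \<longleftrightarrow>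
    (\<forall>n<k. (pfst (seq_nth t n) = 0 \<longrightarrow> S s' i (psnd (seq_nth t n))) \<and>
           (pfst (seq_nth t n) = 1 \<longrightarrow> \<not> S s i (psnd (seq_nth t n)))) \<and>
    ((\<exists>n<k. pfst (seq_nth t n) = 0 \<and> \<not> S s j (psnd (seq_nth t n)) \<or>
            pfst (seq_nth t n) = 1 \<and> S s' j (psnd (seq_nth t n))) \<or>
     (S s j x \<longrightarrow> S s' i x) \<and> (S s i x \<longrightarrow> S s' j x))"

text \<open>By monotonicity each membership holds at all large stages, hence so do the finitely many
  positive examples together. For a consistent competitor, inconsistency is no excuse beyond that
  point, and the matrix forces equality. Conversely, \<open>s'\<close> exists because every required
  clause holds eventually.\<close>

lemma teaching_matrix_iff:
  assumes L: "\<And>j x. x \<in> L j \<longleftrightarrow> (\<exists>s. S s j x)"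
    and mono: "\<And>s s' j x. S s j x \<Longrightarrow> s \<le> s' \<Longrightarrow> S s' j x"
  shows "(\<forall>j x s. \<exists>s'. teaching_matrix S k i t j x s s') \<longleftrightarrow>
    teaching_set (coded_examples k t) (L i) (range L)"
proof
  let ?v = "seq_nth t"
  have ev: "\<forall>\<^sub>F s in sequentially. S s j x" if "x \<in> L j" for j x
    using that L mono unfolding eventually_sequentially by blast
  have ev_all: "\<forall>\<^sub>F s in sequentially. \<forall>n<k. pfst (?v n) = 0 \<longrightarrow> S s j (psnd (?v n))"
    if "consistent (coded_examples k t) (L j)" for j
  proof -
    have "\<forall>\<^sub>F s in sequentially. \<forall>n\<in>{..<k}. pfst (?v n) = 0 \<longrightarrow> S s j (psnd (?v n))"
      using that ev unfolding consistent_coded_examples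
      by (intro eventually_ball_finite) auto
    then show ?thesis by (rule eventually_mono) simp
  qed
  {
    assume m: "\<forall>j x s. \<exists>s'. teaching_matrix S k i t j x s s'"
    have con: "consistent (coded_examples k t) (L i)"
      unfolding consistent_coded_examples
    proof (intro allI impI conjI)
      fix n assume n: "n < k"
      \<comment> \<open>The clause on the examples mentions neither the competitor nor
        \<open>x\<close>, so any instance will do.\<close>
      obtain s' where "teaching_matrix S k i t i 0 0 s'" using m by blast
      then show "psnd (?v n) \<in> L i" if "pfst (?v n) = 0"
        using that n L unfolding teaching_matrix_def by blast
      show "psnd (?v n) \<notin> L i" if "pfst (?v n) = 1"
      proof
        assume "psnd (?v n) \<in> L i"
        then obtain s where "S s i (psnd (?v n))" using L by blast
        moreover obtain s' where "teaching_matrix S k i t i 0 s s'" using m by blast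
        ultimately show False using that n unfolding teaching_matrix_def by blast
      qed
    qed
    have "L j = L i" if cj: "consistent (coded_examples k t) (L j)" for j
    proof -
      obtain s0 where s0: "\<And>n. n < k \<Longrightarrow> pfst (?v n) = 0 \<Longrightarrow> S s0 j (psnd (?v n))"
        using ev_all[OF cj] unfolding eventually_sequentially by blast
      have "\<exists>s'. (S s j x \<longrightarrow> S s' i x) \<and> (S s i x \<longrightarrow> S s' j x)" if "s0 \<le> s" for s x
      proof -
        obtain s' where "teaching_matrix S k i t j x s s'" using m by blast
        moreover have "\<not> (\<exists>n<k. pfst (?v n) = 0 \<and> \<not> S s j (psnd (?v n)) \<or>
            pfst (?v n) = 1 \<and> S s' j (psnd (?v n)))"
          using s0 mono[OF _ that] cj L unfolding consistent_coded_examples by blast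
        ultimately show ?thesis unfolding teaching_matrix_def by blast
      qed
      \<comment> \<open>Agreement is known for stages from \<open>s0\<close> on; raising
        \<open>s\<close> to \<open>max s0 s\<close> loses no element by monotonicity.\<close>
      then have tr: "\<exists>s'. (S (max s0 s) j x \<longrightarrow> S s' i x) \<and> (S (max s0 s) i x \<longrightarrow> S s' j x)" for s x
        by simp
      have up: "S s j' x \<Longrightarrow> S (max s0 s) j' x" for s j' x
        using mono[of s j' x "max s0 s"] by simp
      show ?thesis
      proof (intro set_eqI iffI)
        fix x
        show "x \<in> L i" if "x \<in> L j" using that tr up L by blast
        show "x \<in> L j" if "x \<in> L i" using that tr up L by blast
      qed
    qed
    then show "teaching_set (coded_examples k t) (L i) (range L)"
      using con unfolding teaching_set_def by blast
  }
  {
    assume teach: "teaching_set (coded_examples k t) (L i) (range L)"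
    then have con: "consistent (coded_examples k t) (L i)" by (simp add: teaching_set_def)
    show "\<forall>j x s. \<exists>s'. teaching_matrix S k i t j x s s'"
    proof (intro allI)
      fix j x s
      have ind: "\<forall>\<^sub>F s' in sequentially. S s j' x \<longrightarrow> S s' i' x" if "L j' = L i'" for j' i'
      proof (cases "S s j' x")
        case True
        then have "x \<in> L i'" using that L by blast
        from ev[OF this] show ?thesis by simp
      qed simp
      \<comment> \<open>For fixed \<open>s\<close> the competitor clause holds at all large
        \<open>s'\<close>, either by equality of the languages or by an example that
        \<open>L j\<close> violates. It can thus be met together with the positive examples of
        \<open>L i\<close>.\<close>
      have "\<forall>\<^sub>F s' in sequentially.
        (\<exists>n<k. pfst (?v n) = 0 \<and> \<not> S s j (psnd (?v n)) \<or>
            pfst (?v n) = 1 \<and> S s' j (psnd (?v n))) \<or>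
        (S s j x \<longrightarrow> S s' i x) \<and> (S s i x \<longrightarrow> S s' j x)"
      proof (cases "L j = L i")
        case True
        from ind[OF True] ind[OF True[symmetric]] show ?thesis by eventually_elim blast
      next
        case False
        then have "\<not> consistent (coded_examples k t) (L j)"
          using teach unfolding teaching_set_def by blast
        then obtain n where n: "n < k"
          "pfst (?v n) = 0 \<and> psnd (?v n) \<notin> L j \<or> pfst (?v n) = 1 \<and> psnd (?v n) \<in> L j"
          unfolding consistent_coded_examples by blast
        from n(2) have "\<forall>\<^sub>F s' in sequentially. pfst (?v n) = 0 \<and> \<not> S s j (psnd (?v n)) \<or>
            pfst (?v n) = 1 \<and> S s' j (psnd (?v n))"
        proof
          assume "pfst (?v n) = 0 \<and> psnd (?v n) \<notin> L j"
          then show ?thesis using L by simp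
        next
          assume v: "pfst (?v n) = 1 \<and> psnd (?v n) \<in> L j"
          from ev[of "psnd (?v n)" j] v show ?thesis by (auto elim: eventually_mono)
        qed
        then show ?thesis by eventually_elim (use n(1) in blast)
      qed
      with ev_all[OF con] have "\<forall>\<^sub>F s' in sequentially. teaching_matrix S k i t j x s s'"
        unfolding teaching_matrix_def
        by eventually_elim (use con L in \<open>auto simp: consistent_coded_examples\<close>)
      then show "\<exists>s'. teaching_matrix S k i t j x s s'"
        by (rule eventually_happens'[OF sequentially_bot])
    qed
  }
qed

lemma I_TD_Sigma5:
  assumes "uniformly_re W"
  shows "Sigma0 5 (I_TD W)"
proof -
  obtain S where S: "decidable 3 (\<lambda>\<sigma>. S (\<sigma> 0) (\<sigma> 1) (\<sigma> 2))"
    and W: "\<And>e x. x \<in> W e \<longleftrightarrow> (\<exists>s. S s e x)" and mono: "\<And>s t e x. S s e x \<Longrightarrow> s \<le> t \<Longrightarrow> S t e x"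
    by (rule uniformly_re_approximation[OF assms]) (rule that)
  define M where "M = (\<lambda>e k i t z s'. teaching_matrix (\<lambda>s j x. S s e (prod_encode (j, x)))
    k i t (pfst z) (pfst (psnd z)) (psnd (psnd z)) s')"
  let ?R = "\<lambda>xs. M (xs ! 0) (xs ! 1) (xs ! 2) (xs ! 3) (xs ! 4) (xs ! 5)"
  \<comment> \<open>Pairing merges the universal quantifiers over \<open>j\<close>, \<open>x\<close>
    and \<open>s\<close>, which leaves exactly five alternating quantifiers.\<close>
  have all3: "(\<forall>z. Q (pfst z) (pfst (psnd z)) (psnd (psnd z))) \<longleftrightarrow> (\<forall>j x s. Q j x s)" for Q
    by (metis pfst_psnd)
  have fam: "family W e = range (lang W e)" for e by (auto simp: family_def)
  have "e \<in> I_TD W \<longleftrightarrow> (\<exists>k. \<forall>i. \<exists>t. \<forall>z. \<exists>s. M e k i t z s)" for e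
  proof -
    have "(\<forall>z. \<exists>s. M e k i t z s) \<longleftrightarrow>
      teaching_set (coded_examples k t) (lang W e i) (range (lang W e))" for k i t
    proof -
      have "(\<forall>z. \<exists>s. M e k i t z s) \<longleftrightarrow> (\<forall>j x s. \<exists>s'.
          teaching_matrix (\<lambda>s j x. S s e (prod_encode (j, x))) k i t j x s s')"
        unfolding M_def by (rule all3)
      also have "\<dots> \<longleftrightarrow> teaching_set (coded_examples k t) (lang W e i) (range (lang W e))"
        by (rule teaching_matrix_iff) (simp_all add: lang_def W mono)
      finally show ?thesis .
    qed
    moreover have "(\<exists>T. finite T \<and> card T \<le> k \<and> P T) \<longleftrightarrow> (\<exists>t. P (coded_examples k t))" for k P
    proof
      assume "\<exists>T. finite T \<and> card T \<le> k \<and> P T"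
      then obtain T where "finite T" "card T \<le> k" "P T" by blast
      then show "\<exists>t. P (coded_examples k t)" using ex_coded_examples[of T k] by blast
    qed (use coded_examples_finite in blast)
    ultimately show ?thesis
      unfolding I_TD_def fam TD_family_finite_iff by simp
  qed
  moreover have "ex_prefix 5 ?R [e] \<longleftrightarrow> (\<exists>k. \<forall>i. \<exists>t. \<forall>z. \<exists>s. M e k i t z s)" for e
    by (simp add: numeral_eq_Suc)
  moreover have "recursive_rel 6 ?R"
  proof -
    have "decidable 6 (\<lambda>\<sigma>. M (\<sigma> 0) (\<sigma> 1) (\<sigma> 2) (\<sigma> 3) (\<sigma> 4) (\<sigma> 5))"
      unfolding M_def teaching_matrix_def
      by (intro comp_intros decidable_apply3[OF S]; simp)
    then show ?thesis unfolding recursive_rel_iff by (simp add: numeral_2_eq_2)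
  qed
  ultimately show ?thesis
    unfolding Sigma0_def by (intro exI[of _ ?R]) simp
qed

section \<open>Hardness\<close>

text \<open>With \<open>j = \<langle>\<langle>a, b\<rangle>, \<langle>i, \<langle>l, c\<rangle>\<rangle>\<rangle>\<close> the language \<open>j\<close> lives in the gadget \<open>\<langle>a, b\<rangle>\<close>, whose elements
  are \<open>\<langle>\<langle>a, b\<rangle>, \<langle>tag, v\<rangle>\<rangle>\<close>. For \<open>i > a\<close> it is the target \<open>{t\<^sub>0, \<dots>, t\<^sub>a}\<close> of the gadget (tag 0). For
  \<open>i \<le> a\<close> it misses \<open>t\<^sub>i\<close>, has a private element (tag 1), and contains the element with tag
  \<open>a' + 2\<close> and \<open>v = m\<close> if \<open>m \<ge> l\<close> or if the guess for a refutation of \<open>m\<close> that is coded in \<open>c\<close> fails.\<close>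

definition gadget_approx ::
  "(nat \<Rightarrow> nat \<Rightarrow> nat \<Rightarrow> nat \<Rightarrow> nat \<Rightarrow> bool) \<Rightarrow> nat \<Rightarrow> nat \<Rightarrow> nat \<Rightarrow> bool" where
  "gadget_approx P s j y \<longleftrightarrow> pfst y = pfst j \<and>
    (pfst (psnd y) = 0 \<and> psnd (psnd y) \<le> pfst (pfst j) \<and> psnd (psnd y) \<noteq> pfst (psnd j) \<or>
     pfst (psnd j) \<le> pfst (pfst j) \<and>
      (pfst (psnd y) = 1 \<and> psnd (psnd y) = psnd j \<or>
       2 \<le> pfst (psnd y) \<and> pfst (psnd y) - 2 \<le> pfst (pfst j) \<and>
        (pfst (psnd (psnd j)) \<le> psnd (psnd y) \<or>
         P (pfst (psnd y) - 2) (seq_nth (psnd (pfst j)) (pfst (psnd y) - 2)) (psnd (psnd y))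
           (seq_nth (psnd (psnd (psnd j))) (prod_encode (pfst (psnd y) - 2, psnd (psnd y)))) s)))"

definition gadget_lang :: "(nat \<Rightarrow> nat \<Rightarrow> nat \<Rightarrow> nat \<Rightarrow> nat \<Rightarrow> bool) \<Rightarrow> nat \<Rightarrow> nat set" where
  "gadget_lang P j = {y. \<exists>s. gadget_approx P s j y}"

definition elt :: "nat \<Rightarrow> nat \<Rightarrow> nat \<Rightarrow> nat" where
  "elt g tag v = prod_encode (g, prod_encode (tag, v))"

definition lang_index :: "nat \<Rightarrow> nat \<Rightarrow> nat \<Rightarrow> nat \<Rightarrow> nat \<Rightarrow> nat" where
  "lang_index a b i l c = prod_encode (prod_encode (a, b), prod_encode (i, prod_encode (l, c)))"

lemma elt_cases: obtains g v where "y = elt g 0 v" | g v where "y = elt g 1 v"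
  | g a m where "y = elt g (a + 2) m"
proof -
  have y: "y = elt (pfst y) (pfst (psnd y)) (psnd (psnd y))" by (simp add: elt_def)
  show thesis
  proof (cases "pfst (psnd y)")
    case 0
    with y show thesis by (intro that(1)) simp
  next
    case (Suc n)
    with y show thesis by (cases n) (auto intro: that(2,3))
  qed
qed

lemma lang_index_cases: obtains a b i l c where "j = lang_index a b i l c"
proof -
  have "j = lang_index (pfst (pfst j)) (psnd (pfst j)) (pfst (psnd j)) (pfst (psnd (psnd j)))
      (psnd (psnd (psnd j)))"
    by (simp add: lang_index_def)
  then show thesis by (rule that)
qed

lemma elt_inject [simp]: "elt g tag v = elt g' tag' v' \<longleftrightarrow> g = g' \<and> tag = tag' \<and> v = v'"
  by (simp add: elt_def)

text \<open>A bound on all elements of a finite example set thereby bounds the numbers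
  \<open>v\<close> inside them.\<close>

lemma le_elt: "v \<le> elt g tag v"
  unfolding elt_def by (rule le_trans[OF le_prod_encode_2 le_prod_encode_2])

lemma gadget_lang_iff [simp]:
  "elt g 0 v \<in> gadget_lang P (lang_index a b i l c) \<longleftrightarrow> g = prod_encode (a, b) \<and> v \<le> a \<and> v \<noteq> i"
  "elt g (Suc 0) v \<in> gadget_lang P (lang_index a b i l c) \<longleftrightarrow>
    g = prod_encode (a, b) \<and> i \<le> a \<and> v = prod_encode (i, prod_encode (l, c))"
  "elt g (Suc (Suc a')) m \<in> gadget_lang P (lang_index a b i l c) \<longleftrightarrow>
    g = prod_encode (a, b) \<and> i \<le> a \<and> a' \<le> a \<and>
    (l \<le> m \<or> (\<exists>s. P a' (seq_nth b a') m (seq_nth c (prod_encode (a', m))) s))"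
  unfolding gadget_lang_def gadget_approx_def elt_def lang_index_def by simp_all

text \<open>Past \<open>a\<close> every clause that reads \<open>l\<close> or \<open>c\<close> is
  switched off and no element of tag 0 is removed, so a gadget has a single target.\<close>

lemma target_cong:
  assumes "a < i" "a < i'"
  shows "gadget_lang P (lang_index a b i l c) = gadget_lang P (lang_index a b i' l' c')"
proof (rule set_eqI)
  fix y
  show "y \<in> gadget_lang P (lang_index a b i l c) \<longleftrightarrow> y \<in> gadget_lang P (lang_index a b i' l' c')"
  proof (cases y rule: elt_cases)
    case (1 g v)
    then show ?thesis using assms by auto
  next
    case (2 g v)
    then show ?thesis using assms by simp
  next
    case (3 g v)
    then show ?thesis using assms by simp
  qed
qed

text \<open>One private example teaches a competitor. A target is taught by its \<open>a + 1\<close>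
  elements if \<open>a < a0\<close>, and otherwise by two examples built from a witness
  \<open>m\<close> for \<open>a0\<close>; \<open>a0 + 2\<close> covers all three cases.\<close>

lemma gadget_bounded:
  assumes A: "\<And>b. \<exists>m. \<forall>c. \<exists>s. P a0 b m c s"
  shows "\<exists>T. finite T \<and> card T \<le> a0 + 2 \<and> teaching_set T (gadget_lang P j) (range (gadget_lang P))"
proof -
  obtain a b i l c where j: "j = lang_index a b i l c" by (rule lang_index_cases)
  let ?g = "prod_encode (a, b)"
  let ?L = "gadget_lang P"
  have teach: "teaching_set T (?L j) (range ?L)" if "consistent T (?L j)"
    "\<And>a' b' i' l' c'. consistent T (?L (lang_index a' b' i' l' c')) \<Longrightarrow>
      ?L (lang_index a' b' i' l' c') = ?L j" for T
    unfolding teaching_set_def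
  proof (intro conjI ballI notI)
    fix L'
    assume "L' \<in> range ?L - {?L j}" "consistent T L'"
    moreover then obtain j' where "L' = ?L j'" by blast
    moreover obtain a' b' i' l' c' where "j' = lang_index a' b' i' l' c'" by (rule lang_index_cases)
    ultimately show False using that(2)[of a' b' i' l' c'] by simp
  qed (rule that(1))
  consider "i \<le> a" | "a < i" "a < a0" | "a < i" "a0 \<le> a" by linarith
  then show ?thesis
  proof cases
    case 1
    let ?T = "{(elt ?g 1 (prod_encode (i, prod_encode (l, c))), Plus)}"
    have "teaching_set ?T (?L j) (range ?L)"
      by (rule teach) (use 1 in \<open>auto simp: consistent_def j\<close>)
    then show ?thesis by (intro exI[of _ ?T]) simp
  next
    case 2
    let ?T = "(\<lambda>v. (elt ?g 0 v, Plus)) ` {..a}"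
    have "teaching_set ?T (?L j) (range ?L)"
    proof (rule teach)
      show "consistent ?T (?L j)" using 2 by (auto simp: consistent_def j)
      fix a' b' i' l' c'
      assume "consistent ?T (?L (lang_index a' b' i' l' c'))"
      then have *: "elt ?g 0 v \<in> ?L (lang_index a' b' i' l' c')" if "v \<le> a" for v
        using that by (auto simp: consistent_def)
      from *[of 0] have "a' = a" "b' = b" by auto
      \<comment> \<open>For \<open>i' \<le> a\<close> the language would lack the required element
        with number \<open>i'\<close>.\<close>
      moreover have "a < i'" using *[of i'] by fastforce
      ultimately show "?L (lang_index a' b' i' l' c') = ?L j"
        unfolding j using target_cong 2 by blast
    qed
    moreover have "card ?T \<le> a0 + 2" using card_image_le[of "{..a}" "\<lambda>v. (elt ?g 0 v, Plus)"] 2 by simp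
    ultimately show ?thesis by blast
  next
    case 3
    obtain m where m: "\<And>c. \<exists>s. P a0 (seq_nth b a0) m c s" using A by blast
    let ?T = "{(elt ?g 0 0, Plus), (elt ?g (a0 + 2) m, Minus)}"
    have "teaching_set ?T (?L j) (range ?L)"
    proof (rule teach)
      show "consistent ?T (?L j)" using 3 by (auto simp: consistent_def j)
      fix a' b' i' l' c'
      assume "consistent ?T (?L (lang_index a' b' i' l' c'))"
      then have *: "elt ?g 0 0 \<in> ?L (lang_index a' b' i' l' c')"
        "elt ?g (a0 + 2) m \<notin> ?L (lang_index a' b' i' l' c')"
        by (auto simp: consistent_def)
      then have "a' = a" "b' = b" by auto
      \<comment> \<open>For \<open>i' \<le> a\<close> the choice of \<open>m\<close> would put the
        negative example into the language, whatever the guess \<open>c'\<close>.\<close>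
      moreover have "a < i'" using * m 3 by auto
      ultimately show "?L (lang_index a' b' i' l' c') = ?L j"
        unfolding j using target_cong 3 by blast
    qed
    then show ?thesis by (intro exI[of _ ?T]) simp
  qed
qed

lemma gadget_unbounded:
  assumes A: "\<And>a. \<exists>b. \<forall>m. \<exists>c. \<forall>s. \<not> P a b m c s"
  shows "\<exists>j. \<forall>T. finite T \<and> card T \<le> k \<longrightarrow>
    \<not> teaching_set T (gadget_lang P j) (range (gadget_lang P))"
proof -
  \<comment> \<open>Skolem functions: \<open>B a\<close> is a value of \<open>b\<close> without a
    witness, and \<open>C a m\<close> refutes \<open>m\<close> as one.\<close>
  obtain B C where BC: "\<And>a m s. \<not> P a (B a) m (C a m) s" using A by metis
  obtain b where b: "\<And>a. a \<le> k \<Longrightarrow> seq_nth b a = B a"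
    using ex_seq_nth[of "Suc k" B] by (auto simp: less_Suc_eq_le)
  \<comment> \<open>With \<open>a = k\<close> the target has \<open>k + 1\<close> elements, one more
    than \<open>T\<close> can list; \<open>Suc k\<close> in the next index selects this
    target.\<close>
  let ?L = "gadget_lang P" and ?g = "prod_encode (k, b)"
  let ?j = "lang_index k b (Suc k) 0 0"
  have False if T: "finite T" "card T \<le> k" and teach: "teaching_set T (?L ?j) (range ?L)" for T
  proof -
    have con: "consistent T (?L ?j)" using teach by (simp add: teaching_set_def)
    have "\<exists>i\<le>k. (elt ?g 0 i, Plus) \<notin> T"
    proof (rule ccontr)
      assume "\<not> ?thesis"
      then have "(\<lambda>i. (elt ?g 0 i, Plus)) ` {..k} \<subseteq> T" by auto
      then have "card ((\<lambda>i. (elt ?g 0 i, Plus)) ` {..k}) \<le> k"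
        using card_mono[OF T(1)] T(2) le_trans by blast
      moreover have "inj_on (\<lambda>i. (elt ?g 0 i, Plus)) {..k}" by (auto simp: inj_on_def)
      ultimately show False by (simp add: card_image)
    qed
    then obtain i where i: "i \<le> k" "(elt ?g 0 i, Plus) \<notin> T" by blast
    \<comment> \<open>\<open>l\<close> lies above all elements of \<open>T\<close>. The private
      element contains \<open>l\<close> and is therefore at least \<open>l\<close>, so it escapes
      \<open>T\<close>, as do the elements with \<open>l \<le> m\<close>.\<close>
    obtain l where l: "\<And>y s. (y, s) \<in> T \<Longrightarrow> y < l"
      using finite_nat_set_iff_bounded[of "fst ` T"] T(1) by force
    \<comment> \<open>Only the finitely many pairs with \<open>a \<le> k\<close> and
      \<open>m < l\<close> remain to be refuted, so a single number \<open>c\<close> can code all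
      the refutations.\<close>
    obtain N where N: "\<And>a m. a \<le> k \<Longrightarrow> m < l \<Longrightarrow> prod_encode (a, m) < N"
      using finite_nat_set_iff_bounded[of "prod_encode ` ({..k} \<times> {..<l})"] by auto
    obtain c where c: "\<And>n. n < N \<Longrightarrow> seq_nth c n = C (pfst n) (psnd n)"
      using ex_seq_nth[of N "\<lambda>n. C (pfst n) (psnd n)"] by blast
    let ?j' = "lang_index k b i l c"
    have "consistent T (?L ?j')"
      unfolding consistent_def
    proof (intro conjI subsetI equals0I)
      fix y
      assume "y \<in> {n. (n, Plus) \<in> T}"
      then have y: "(y, Plus) \<in> T" by simp
      then have "y \<in> ?L ?j" using con by (auto simp: consistent_def)
      then show "y \<in> ?L ?j'"
        using y i(2) by (cases y rule: elt_cases) auto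
    next
      fix y
      assume "y \<in> {n. (n, Minus) \<in> T} \<inter> ?L ?j'"
      then have y: "(y, Minus) \<in> T" "y \<in> ?L ?j'" by auto
      have "y \<notin> ?L ?j" using con y(1) by (auto simp: consistent_def)
      then show False
      proof (cases y rule: elt_cases)
        case (1 g v)
        then show ?thesis using y(2) \<open>y \<notin> ?L ?j\<close> by simp
      next
        case (2 g v)
        then have "v = prod_encode (i, prod_encode (l, c))" using y(2) by simp
        then have "l \<le> y"
          unfolding 2(1)
          using le_elt le_prod_encode_1[of l c] le_prod_encode_2[of "prod_encode (l, c)" i] le_trans
          by meson
        then show ?thesis using l[OF y(1)] by simp
      next
        case (3 g a m)
        have m: "m < l" using l[OF y(1)] le_elt[of m g "a + 2"] 3 by simp
        then obtain s where a: "a \<le> k" and s: "P a (seq_nth b a) m (seq_nth c (prod_encode (a, m))) s"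
          using y(2) 3 by auto
        then show ?thesis using BC b[OF a] c[OF N[OF a m]] by simp
      qed
    qed
    moreover have "?L ?j' \<noteq> ?L ?j"
    proof -
      have "elt ?g 0 i \<in> ?L ?j" "elt ?g 0 i \<notin> ?L ?j'" using i(1) by auto
      then show ?thesis by blast
    qed
    ultimately show False using teach unfolding teaching_set_def by blast
  qed
  then show ?thesis by blast
qed

lemma I_TD_hard:
  assumes W: "acceptable_numbering W" and "Sigma0 5 B"
  shows "many_one_reducible B (I_TD W)"
proof -
  obtain R where R: "recursive_rel 6 R" and B: "\<And>x. x \<in> B \<longleftrightarrow> ex_prefix 5 R [x]"
    using assms(2) unfolding Sigma0_def by auto
  define P where "P = (\<lambda>x a b m c s. R [x, a, b, m, c, s])"
  have B': "x \<in> B \<longleftrightarrow> (\<exists>a. \<forall>b. \<exists>m. \<forall>c. \<exists>s. P x a b m c s)" for x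
    unfolding B P_def by (simp add: numeral_eq_Suc)
  have dec: "decidable k (\<lambda>\<sigma>. P (a0 \<sigma>) (a1 \<sigma>) (a2 \<sigma>) (a3 \<sigma>) (a4 \<sigma>) (a5 \<sigma>))"
    if "computable k a0" "computable k a1" "computable k a2" "computable k a3" "computable k a4"
      "computable k a5" for k a0 a1 a2 a3 a4 a5
  proof -
    have "decidable k (\<lambda>\<sigma>. R (map (\<lambda>g. g \<sigma>) [a0, a1, a2, a3, a4, a5]))"
      by (rule decidable_recursive_rel) (use R that in \<open>auto simp: numeral_eq_Suc\<close>)
    then show ?thesis by (simp add: P_def)
  qed
  \<comment> \<open>The set for \<open>x\<close> consists of pairs of language number and element,
    the format that \<open>lang\<close> decodes; acceptability then supplies the reduction
    \<open>f\<close>.\<close>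
  let ?V = "\<lambda>x. {z. \<exists>s. gadget_approx (P x) s (pfst z) (psnd z)}"
  have "decidable 3 (\<lambda>\<sigma>. gadget_approx (P (\<sigma> 1)) (\<sigma> 0) (pfst (\<sigma> 2)) (psnd (\<sigma> 2)))"
    unfolding gadget_approx_def by (intro comp_intros dec; simp)
  then have "uniformly_re ?V"
    by (rule uniformly_re_ex[of "\<lambda>s x z. gadget_approx (P x) s (pfst z) (psnd z)"])
  then obtain f where f: "recursive_fun f" and V: "\<And>x. ?V x = W (f x)"
    using W unfolding acceptable_numbering_def by blast
  have fam: "family W (f x) = range (gadget_lang (P x))" for x
    by (auto simp: family_def lang_def gadget_lang_def V[symmetric])
  have I: "f x \<in> I_TD W \<longleftrightarrow> (\<exists>k. \<forall>j. \<exists>T. finite T \<and> card T \<le> k \<and>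
      teaching_set T (gadget_lang (P x) j) (range (gadget_lang (P x))))" for x
    unfolding I_TD_def mem_Collect_eq fam TD_family_finite_iff by simp
  have "x \<in> B \<longleftrightarrow> f x \<in> I_TD W" for x
  proof (cases "x \<in> B")
    case True
    then obtain a where "\<And>b. \<exists>m. \<forall>c. \<exists>s. P x a b m c s" unfolding B' by blast
    from gadget_bounded[of "P x", OF this] True show ?thesis unfolding I by blast
  next
    case False
    then have "\<exists>b. \<forall>m. \<exists>c. \<forall>s. \<not> P x a b m c s" for a unfolding B' by simp
    from gadget_unbounded[of "P x", OF this] False show ?thesis unfolding I by blast
  qed
  then show ?thesis unfolding many_one_reducible_def using f by blast
qed

theorem theorem6:
  fixes W :: "nat \<Rightarrow> nat set"
  assumes "acceptable_numbering W"
  shows "Sigma0_complete 5 (I_TD W)"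
  using assms I_TD_Sigma5 I_TD_hard unfolding Sigma0_complete_def acceptable_numbering_def by blast

end
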